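(* If $G$ is a connected graph that is claw-$o_{-1}$-heavy and $P_4$-free, then $G$ is traceable.
   Context: All graphs are finite and simple; $d(v)$ is the degree of $v$ in $G$. A claw is $K_{1,3}$. $G$ (on $n$ vertices) is claw-$o_{-1}$-heavy if every induced subgraph of $G$ isomorphic to $K_{1,3}$ contains two nonadjacent vertices whose degree sum in $G$ is at least $n-1$. $P_4$ is the path on 4 vertices; $G$ is $P_4$-free if it has no induced subgraph isomorphic to $P_4$. Traceable means having a path through all vertices. *)

theory Defs
  imports "Graph_Theory.Graph_Theory"
begin

text \<open>
  Finite simple graphs are the library's \<^locale>\<open>graph\<close>s: finite, loop-free, symmetric digraphs
  without parallel arcs. Every edge is thus a pair of opposite arcs, and the degree of a vertex in
  the undirected sense is its \<^const>\<open>out_degree\<close>.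
\<close>

definition path_graph :: "nat \<Rightarrow> nat pair_pre_digraph" where
  "path_graph k = \<lparr> pverts = {..<k},
     parcs = {(i, j). i < k \<and> j < k \<and> (j = Suc i \<or> i = Suc j)} \<rparr>"

lemma pair_graph_path_graph: "pair_graph (path_graph k)"
proof -
  have "finite {(i, j). i < k \<and> j < k \<and> (j = Suc i \<or> i = Suc j)}"
    by (rule finite_subset[of _ "{..<k} \<times> {..<k}"]) auto
  then show ?thesis
    by unfold_locales (auto simp: path_graph_def symmetric_def sym_def)
qed

definition P4_free :: "('a, 'b) pre_digraph \<Rightarrow> bool" where
  "P4_free G \<longleftrightarrow>
     \<not> (\<exists>H. induced_subgraph H G \<and> digraph_iso H (with_proj (path_graph 4)))"

text \<open>
  \<^const>\<open>complete_bipartite_digraph\<close> is closed under isomorphism, so the induced claws of \<open>G\<close> are the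
  induced subgraphs \<open>H\<close> with \<open>complete_bipartite_digraph 1 3 H\<close>. The subtraction on natural
  numbers is exact, since a graph that contains a claw has vertices.
\<close>

definition claw_o_minus_1_heavy :: "('a, 'b) pre_digraph \<Rightarrow> bool" where
  "claw_o_minus_1_heavy G \<longleftrightarrow>
     (\<forall>H. induced_subgraph H G \<and> complete_bipartite_digraph 1 3 H \<longrightarrow>
       (\<exists>u \<in> verts H. \<exists>v \<in> verts H. u \<noteq> v \<and> \<not> u \<rightarrow>\<^bsub>G\<^esub> v \<and>
          out_degree G u + out_degree G v \<ge> card (verts G) - 1))"

definition traceable :: "('a, 'b) pre_digraph \<Rightarrow> bool" where
  "traceable G \<longleftrightarrow> (\<exists>p. vpath p G \<and> set p = verts G)"

end

theory Submission
  imports Defs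
begin

text \<open>
  A \<open>P\<^sub>4\<close>-free graph with at least two vertices is a disjoint union or a join of two smaller ones.
  By induction along this decomposition, its vertices are covered by \<open>k\<close> disjoint paths, where the
  optimality of \<open>k\<close> is certified by a set \<open>S\<close> whose deletion leaves \<open>|S| + k\<close> mutually
  nonadjacent parts. If \<open>k \<ge> 2\<close> and \<open>G\<close> is connected, take such an \<open>S\<close> that leaves at least
  \<open>|S| + 2\<close> parts and is minimal. Then some \<open>s \<in> S\<close> has neighbours in three parts, as otherwise \<open>s\<close>
  could be removed from \<open>S\<close>. These form a claw with centre \<open>s\<close>. A leaf in the part \<open>X\<close> has
  degree less than \<open>|S| + |X|\<close>, and counting the other \<open>\<ge> |S|\<close> parts shows that no two leaves have
  degree sum \<open>\<ge> n - 1\<close>.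
\<close>

section \<open>Decomposition of \<open>P\<^sub>4\<close>-free relations\<close>

definition separated :: "('a \<Rightarrow> 'a \<Rightarrow> bool) \<Rightarrow> 'a set \<Rightarrow> 'a set \<Rightarrow> bool" where
  "separated r A B \<longleftrightarrow> (\<forall>a\<in>A. \<forall>b\<in>B. \<not> r a b)"

definition joined :: "('a \<Rightarrow> 'a \<Rightarrow> bool) \<Rightarrow> 'a set \<Rightarrow> 'a set \<Rightarrow> bool" where
  "joined r A B \<longleftrightarrow> (\<forall>a\<in>A. \<forall>b\<in>B. r a b)"

definition bipartition :: "'a set \<Rightarrow> 'a set \<Rightarrow> 'a set \<Rightarrow> bool" where
  "bipartition V A B \<longleftrightarrow> A \<noteq> {} \<and> B \<noteq> {} \<and> A \<inter> B = {} \<and> A \<union> B = V"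

text \<open>For symmetric irreflexive \<open>r\<close> the condition holds trivially unless \<open>a, b, c, d\<close> are distinct.\<close>

definition no_P4 :: "('a \<Rightarrow> 'a \<Rightarrow> bool) \<Rightarrow> 'a set \<Rightarrow> bool" where
  "no_P4 r V \<longleftrightarrow> (\<forall>a\<in>V. \<forall>b\<in>V. \<forall>c\<in>V. \<forall>d\<in>V.
     r a b \<longrightarrow> r b c \<longrightarrow> r c d \<longrightarrow> r a c \<or> r a d \<or> r b d)"

definition complement_rel :: "('a \<Rightarrow> 'a \<Rightarrow> bool) \<Rightarrow> 'a \<Rightarrow> 'a \<Rightarrow> bool" where
  "complement_rel r x y \<longleftrightarrow> x \<noteq> y \<and> \<not> r x y"

lemma no_P4D:
  assumes "no_P4 r V" "a \<in> V" "b \<in> V" "c \<in> V" "d \<in> V" "r a b" "r b c" "r c d"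
  shows "r a c \<or> r a d \<or> r b d"
  using assms unfolding no_P4_def by blast

lemma no_P4_subset: "no_P4 r V \<Longrightarrow> U \<subseteq> V \<Longrightarrow> no_P4 r U"
  unfolding no_P4_def by blast

lemma symp_complement_rel: "symp r \<Longrightarrow> symp (complement_rel r)"
  unfolding symp_def complement_rel_def by blast

text \<open>The path on four vertices is self-complementary: an induced path \<open>a b c d\<close>
  of the complement is the induced path \<open>b d a c\<close> of \<open>r\<close>.\<close>

lemma no_P4_complement_rel:
  assumes "symp r" "no_P4 r V"
  shows "no_P4 (complement_rel r) V"
  unfolding no_P4_def
proof (intro ballI impI, rule ccontr)
  fix a b c d
  assume V: "a \<in> V" "b \<in> V" "c \<in> V" "d \<in> V"
    and e: "complement_rel r a b" "complement_rel r b c" "complement_rel r c d"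
    and n: "\<not> (complement_rel r a c \<or> complement_rel r a d \<or> complement_rel r b d)"
  have sym: "r x y \<Longrightarrow> r y x" for x y
    using assms(1) by (auto dest: sympD)
  have e': "\<not> r a b" "\<not> r b c" "\<not> r c d"
    and n': "a = c \<or> r a c" "a = d \<or> r a d" "b = d \<or> r b d"
    and ne: "a \<noteq> b" "c \<noteq> d"
    using e n by (auto simp: complement_rel_def)
  have "a \<noteq> c" "a \<noteq> d" "b \<noteq> d"
    using e' n' ne sym by blast+
  then have "r b d" "r d a" "r a c"
    using n' sym by blast+
  then have "r b a \<or> r b c \<or> r d c"
    using no_P4D[OF assms(2) V(2,4,1,3)] by blast
  then show False
    using e' sym by blast
qed

lemma separated_complement_rel:
  "A \<inter> B = {} \<Longrightarrow> separated (complement_rel r) A B \<longleftrightarrow> joined r A B"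
  unfolding separated_def joined_def complement_rel_def
  by (intro ball_cong refl) auto

text \<open>If \<open>v\<close> has no neighbour in \<open>B\<close>, it can join the side
  \<open>A\<close>. Otherwise fix a neighbour \<open>d\<close> of \<open>v\<close> in
  \<open>B\<close> and let \<open>N\<close> be the set of nonneighbours of \<open>v\<close> in
  \<open>A\<close>. An edge from \<open>y\<close> in \<open>N\<close> to \<open>z\<close> in
  \<open>A - N\<close> would yield the induced path \<open>y z v d\<close>, so \<open>N\<close> can
  be split off from everything else; \<open>x\<close> witnesses that \<open>N\<close> is
  nonempty.\<close>

lemma bipartition_insert_of_separated_nonneighbour:
  assumes sym: "symp r" and P4: "no_P4 r (insert v (A \<union> B))"
    and v: "v \<notin> A \<union> B" and AB: "B \<noteq> {}" "A \<inter> B = {}" "separated r A B"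
    and x: "x \<in> A" "\<not> r v x"
  shows "\<exists>A' B'. bipartition (insert v (A \<union> B)) A' B' \<and> separated r A' B'"
proof (cases "separated r {v} B")
  case True
  then have "separated r (insert v A) B"
    using AB by (auto simp: separated_def)
  moreover have "bipartition (insert v (A \<union> B)) (insert v A) B"
    using v AB by (auto simp: bipartition_def)
  ultimately show ?thesis by blast
next
  case False
  then obtain d where d: "d \<in> B" "r v d" by (auto simp: separated_def)
  define N where "N = {y \<in> A. \<not> r v y}"
  have Nz: "\<not> r y z" if "y \<in> N" "z \<in> A - N" for y z
  proof
    assume "r y z"
    moreover have "r z v" using that sym by (auto simp: N_def dest: sympD)
    ultimately have "r y v \<or> r y d \<or> r z d"
      using no_P4D[OF P4, of y z v d] that d by (auto simp: N_def)
    moreover have "\<not> r y v" using that sym by (auto simp: N_def dest: sympD)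
    ultimately show False using AB(3) that d by (auto simp: N_def separated_def)
  qed
  have Nv: "\<not> r y v" if "y \<in> N" for y
    using that sym by (auto simp: N_def dest: sympD)
  have "\<not> r y z" if "y \<in> N" "z \<in> B" for y z
    using that AB(3) by (simp add: separated_def N_def)
  with Nz Nv have "separated r N (insert v ((A - N) \<union> B))"
    unfolding separated_def by blast
  moreover have "bipartition (insert v (A \<union> B)) N (insert v ((A - N) \<union> B))"
    using v AB x by (auto simp: bipartition_def N_def)
  ultimately show ?thesis by blast
qed

lemma bipartition_insert_of_separated:
  assumes sym: "symp r" and P4: "no_P4 r (insert v V)"
    and v: "v \<notin> V" and AB: "bipartition V A B" "separated r A B"
  shows "\<exists>A' B'. bipartition (insert v V) A' B' \<and> (separated r A' B' \<or> joined r A' B')"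
proof (cases "joined r {v} V")
  case True
  moreover have "bipartition (insert v V) {v} V"
    using v AB by (auto simp: bipartition_def)
  ultimately show ?thesis by blast
next
  case False
  have V: "V = A \<union> B" "V = B \<union> A" and ne: "A \<noteq> {}" "B \<noteq> {}" "A \<inter> B = {}" "B \<inter> A = {}"
    using AB by (auto simp: bipartition_def)
  have BA: "separated r B A"
    using AB(2) sym by (auto simp: separated_def dest: sympD)
  obtain x where "x \<in> V" "\<not> r v x" using False by (auto simp: joined_def)
  then consider "x \<in> A" | "x \<in> B" using V by blast
  then show ?thesis
  proof cases
    case 1
    then show ?thesis
      using bipartition_insert_of_separated_nonneighbour[of r v A B x] assms ne V(1) \<open>\<not> r v x\<close> by metis
  next
    case 2
    then show ?thesis
      using bipartition_insert_of_separated_nonneighbour[of r v B A x] assms ne BA V(2) \<open>\<not> r v x\<close> by metis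
  qed
qed

lemma no_P4_bipartition:
  assumes "finite V" "card V \<ge> 2" "symp r" "no_P4 r V"
  shows "\<exists>A B. bipartition V A B \<and> (separated r A B \<or> joined r A B)"
  using assms
proof (induction V rule: finite_induct)
  case empty
  then show ?case by simp
next
  case (insert v V)
  show ?case
  proof (cases "card V \<ge> 2")
    case True
    then obtain A B where AB: "bipartition V A B" "separated r A B \<or> joined r A B"
      using insert.IH insert.prems no_P4_subset[OF insert.prems(3)] by blast
    have disj: "A \<inter> B = {}" using AB by (simp add: bipartition_def)
    from AB(2) show ?thesis
    proof
      assume "separated r A B"
      then show ?thesis
        using bipartition_insert_of_separated[of r v V A B] AB insert by blast
    next
      \<comment> \<open>A join is a separation in the complement, which is again free of induced
        four-vertex paths. So the separated case applies there, and its two outcomes swap when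
        translated back.\<close>
      assume "joined r A B"
      then have "separated (complement_rel r) A B"
        using separated_complement_rel[OF disj] by blast
      then obtain A' B' where *: "bipartition (insert v V) A' B'"
        "separated (complement_rel r) A' B' \<or> joined (complement_rel r) A' B'"
        using bipartition_insert_of_separated[of "complement_rel r" v V A B] AB insert
          no_P4_complement_rel symp_complement_rel by metis
      then have "A' \<inter> B' = {}" by (simp add: bipartition_def)
      with *(2) have "joined r A' B' \<or> separated r A' B'"
        by (auto simp: separated_complement_rel) (auto simp: joined_def separated_def complement_rel_def)
      with *(1) show ?thesis by blast
    qed
  next
    case False
    then have "card V = 1" using insert by simp
    then obtain w where "V = {w}" by (auto simp: card_1_singleton_iff)
    then have "bipartition (insert v V) {v} {w}" "separated r {v} {w} \<or> joined r {v} {w}"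
      using insert by (auto simp: bipartition_def separated_def joined_def)
    then show ?thesis by blast
  qed
qed

section \<open>Path covers\<close>

definition path_cover :: "('a \<Rightarrow> 'a \<Rightarrow> bool) \<Rightarrow> 'a set \<Rightarrow> 'a list list \<Rightarrow> bool" where
  "path_cover r V ps \<longleftrightarrow> (\<forall>p\<in>set ps. p \<noteq> [] \<and> successively r p)
     \<and> distinct (concat ps) \<and> set (concat ps) = V"

lemma path_cover_append:
  assumes "path_cover r A ps" "path_cover r B qs" "A \<inter> B = {}"
  shows "path_cover r (A \<union> B) (ps @ qs)"
  using assms unfolding path_cover_def by auto

text \<open>With fewer paths than vertices, some path has at least two vertices, and its first
  vertex can be cut off as a path of its own.\<close>

lemma path_cover_split:
  assumes "path_cover r V ps" "length ps < card V"
  shows "\<exists>qs. path_cover r V qs \<and> length qs = Suc (length ps)"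
proof -
  have "\<exists>p\<in>set ps. length p \<ge> 2"
  proof (rule ccontr)
    assume "\<not> ?thesis"
    then have "\<forall>p\<in>set ps. length p \<le> 1" by auto
    then have "length (concat ps) \<le> length ps"
      by (induction ps) auto
    moreover have "card V = length (concat ps)"
      using assms(1) distinct_card unfolding path_cover_def by metis
    ultimately show False using assms(2) by simp
  qed
  then obtain p where p: "p \<in> set ps" "length p \<ge> 2" by blast
  obtain x y zs where xyz: "p = x # y # zs"
    using p(2) by (auto simp: numeral_2_eq_2 Suc_le_length_iff)
  obtain us vs where "ps = us @ p # vs"
    using p(1) by (meson split_list)
  then have "path_cover r V (us @ [x] # (y # zs) # vs) \<and>
      length (us @ [x] # (y # zs) # vs) = Suc (length ps)"
    using assms(1) unfolding path_cover_def xyz by auto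
  then show ?thesis by blast
qed

lemma path_cover_refine:
  assumes "path_cover r V ps" "length ps \<le> m" "m \<le> card V"
  shows "\<exists>qs. path_cover r V qs \<and> length qs = m"
  using assms(2,3)
proof (induction m rule: dec_induct)
  case base
  then show ?case using assms(1) by blast
next
  case (step m)
  then show ?case using path_cover_split by (metis Suc_le_eq less_imp_le)
qed

text \<open>
  Every vertex of \<open>A\<close> glues two paths together. The glued paths run through \<open>A\<close>, but their ends stay
  in \<open>W\<close>, which is what allows further gluing.
\<close>

lemma path_cover_merge:
  assumes "finite A" "path_cover r V ps" "\<forall>p\<in>set ps. hd p \<in> W \<and> last p \<in> W"
    and "joined r A W" "joined r W A" "A \<inter> V = {}" "length ps = k + card A" "k \<ge> 1"
  shows "\<exists>qs. path_cover r (V \<union> A) qs \<and> length qs = k \<and> (\<forall>p\<in>set qs. hd p \<in> W \<and> last p \<in> W)"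
  using assms
proof (induction A arbitrary: V ps rule: finite_induct)
  case empty
  then show ?case by auto
next
  case (insert a A)
  have len: "length ps = k + card A + 1"
    using insert by simp
  then obtain p q qs where ps: "ps = p # q # qs"
    using \<open>k \<ge> 1\<close> by (cases ps; cases "tl ps") auto
  let ?ps = "(p @ a # q) # qs"
  have a: "a \<notin> V" "r (last p) a" "r a (hd q)"
    using insert.prems ps by (auto simp: joined_def)
  have pq: "p \<noteq> []" "q \<noteq> []" "successively r p" "successively r q"
    using insert.prems(1) ps by (auto simp: path_cover_def)
  have "successively r (p @ a # q)"
    using a pq by (auto simp: successively_append_iff successively_Cons)
  then have "path_cover r (insert a V) ?ps"
    using insert.prems(1) a(1) unfolding ps path_cover_def by auto
  moreover have "\<forall>p\<in>set ?ps. hd p \<in> W \<and> last p \<in> W"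
    using insert.prems(2) pq unfolding ps by auto
  moreover have "joined r A W" "joined r W A" "A \<inter> insert a V = {}"
    using insert by (auto simp: joined_def)
  moreover have "length ?ps = k + card A"
    using len ps by simp
  ultimately obtain qs' where "path_cover r (insert a V \<union> A) qs'" "length qs' = k"
    "\<forall>p\<in>set qs'. hd p \<in> W \<and> last p \<in> W"
    using insert.IH[of "insert a V" ?ps] insert.prems by blast
  then show ?case by auto
qed

lemma path_cover_ends:
  assumes "path_cover r V ps"
  shows "\<forall>p\<in>set ps. hd p \<in> V \<and> last p \<in> V"
  using assms unfolding path_cover_def by auto

lemma path_cover_join_few:
  assumes "finite A" "path_cover r B ps" "joined r A B" "joined r B A" "A \<inter> B = {}"
    and "length ps = k + card A" "k \<ge> 1"
  shows "\<exists>qs. path_cover r (A \<union> B) qs \<and> length qs = k"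
  using path_cover_merge[OF assms(1,2) path_cover_ends[OF assms(2)] assms(3-7)]
  by (auto simp: Un_commute)

text \<open>The cover of \<open>B\<close> is refined to exactly \<open>card A\<close> paths. All
  vertices of \<open>A\<close> but one glue these into a single path; its first vertex still lies in
  \<open>B\<close>, so the vertex \<open>a\<close> held back can be put in front.\<close>

lemma path_cover_join_balanced:
  assumes "finite A" "A \<noteq> {}" "path_cover r B ps" "joined r A B" "joined r B A" "A \<inter> B = {}"
    and "length ps \<le> card A" "card A \<le> card B"
  shows "\<exists>q. path_cover r (A \<union> B) [q]"
proof -
  obtain a where a: "a \<in> A" using assms(2) by blast
  obtain qs where qs: "path_cover r B qs" "length qs = card A"
    using path_cover_refine[OF assms(3,7,8)] by blast
  have "length qs = 1 + card (A - {a})"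
    using qs(2) card.remove[OF assms(1) a] by simp
  moreover have "joined r (A - {a}) B" "joined r B (A - {a})" "(A - {a}) \<inter> B = {}"
    using assms by (auto simp: joined_def)
  ultimately obtain q where q: "path_cover r (B \<union> (A - {a})) [q]" "hd q \<in> B"
    using path_cover_merge[OF _ qs(1) path_cover_ends[OF qs(1)], of "A - {a}" 1] assms(1)
    by (auto simp: length_Suc_conv)
  have "path_cover r (A \<union> B) [a # q]"
    using q a assms(4,6) by (auto simp: path_cover_def successively_Cons joined_def)
  then show ?thesis by blast
qed

section \<open>Scattering families\<close>

text \<open>The parts need not be connected. This admits the trivial family \<open>{V}\<close> for
  every nonempty \<open>V\<close>.\<close>

definition scattered :: "('a \<Rightarrow> 'a \<Rightarrow> bool) \<Rightarrow> 'a set set \<Rightarrow> bool" where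
  "scattered r P \<longleftrightarrow> finite P \<and> {} \<notin> P \<and>
     (\<forall>X\<in>P. \<forall>Y\<in>P. X \<noteq> Y \<longrightarrow> X \<inter> Y = {} \<and> separated r X Y)"

text \<open>For finite \<open>V\<close> this certifies a lower bound on path covers: a path with
  \<open>j\<close> vertices in \<open>S\<close> visits at most \<open>j + 1\<close> parts, so every
  path cover of \<open>V\<close> has at least \<open>k\<close> paths.\<close>

definition scattering :: "('a \<Rightarrow> 'a \<Rightarrow> bool) \<Rightarrow> 'a set \<Rightarrow> nat \<Rightarrow> bool" where
  "scattering r V k \<longleftrightarrow> (\<exists>S P. S \<subseteq> V \<and> scattered r P \<and> \<Union>P = V - S \<and> card P = card S + k)"

lemma scattering_trivial: "V \<noteq> {} \<Longrightarrow> scattering r V 1"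
  unfolding scattering_def scattered_def
  by (rule exI[of _ "{}"], rule exI[of _ "{V}"]) auto

lemma scattering_union:
  assumes "finite A" "finite B" "scattering r A k" "scattering r B l"
    and "A \<inter> B = {}" "separated r A B" "separated r B A"
  shows "scattering r (A \<union> B) (k + l)"
proof -
  obtain S P where P: "S \<subseteq> A" "scattered r P" "\<Union>P = A - S" "card P = card S + k"
    using assms(3) by (auto simp: scattering_def)
  obtain T Q where Q: "T \<subseteq> B" "scattered r Q" "\<Union>Q = B - T" "card Q = card T + l"
    using assms(4) by (auto simp: scattering_def)
  have sub: "X \<subseteq> A" "X \<noteq> {}" if "X \<in> P" for X using P that by (auto simp: scattered_def)
  have sub': "X \<subseteq> B" "X \<noteq> {}" if "X \<in> Q" for X using Q that by (auto simp: scattered_def)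
  \<comment> \<open>Parts are nonempty and \<open>A\<close>, \<open>B\<close> are disjoint, so the
    two families share no part and their cardinalities add up.\<close>
  have cross: "X \<inter> Y = {} \<and> X \<noteq> Y \<and> separated r X Y \<and> separated r Y X" if "X \<in> P" "Y \<in> Q" for X Y
    using sub[OF that(1)] sub'[OF that(2)] assms(5-7) unfolding separated_def by blast
  have "X \<inter> Y = {} \<and> separated r X Y" if XY: "X \<in> P \<union> Q" "Y \<in> P \<union> Q" "X \<noteq> Y" for X Y
  proof -
    consider "X \<in> P" "Y \<in> P" | "X \<in> Q" "Y \<in> Q" | "X \<in> P" "Y \<in> Q" | "Y \<in> P" "X \<in> Q"
      using XY(1,2) by blast
    then show ?thesis
    proof cases
      case 1
      then show ?thesis using P(2) XY(3) by (simp add: scattered_def)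
    next
      case 2
      then show ?thesis using Q(2) XY(3) by (simp add: scattered_def)
    next
      case 3
      then show ?thesis using cross by simp
    next
      case 4
      then show ?thesis using cross[of Y X] by (simp add: Int_commute)
    qed
  qed
  then have "scattered r (P \<union> Q)"
    using P(2) Q(2) unfolding scattered_def by simp
  moreover have "P \<inter> Q = {}" using cross by blast
  then have "card (P \<union> Q) = card P + card Q"
    using P(2) Q(2) by (simp add: card_Un_disjoint scattered_def)
  moreover have "card (S \<union> T) = card S + card T"
    using P(1) Q(1) assms(1,2,5) by (intro card_Un_disjoint) (auto intro: finite_subset)
  moreover have "\<Union>(P \<union> Q) = (A \<union> B) - (S \<union> T)" "S \<union> T \<subseteq> A \<union> B"
    using P Q assms(5) by auto
  ultimately show ?thesis
    unfolding scattering_def using P(4) Q(4)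
    by (intro exI[of _ "S \<union> T"] exI[of _ "P \<union> Q"]) simp
qed

text \<open>Deleting all of \<open>A\<close> in addition leaves the same parts and uses up
  \<open>card A\<close> of the surplus of parts over deleted vertices.\<close>

lemma scattering_add_deleted:
  assumes "finite A" "finite B" "scattering r B (k + card A)" "A \<inter> B = {}"
  shows "scattering r (A \<union> B) k"
proof -
  obtain S P where P: "S \<subseteq> B" "scattered r P" "\<Union>P = B - S" "card P = card S + (k + card A)"
    using assms(3) by (auto simp: scattering_def)
  have "card (A \<union> S) = card A + card S"
    using P(1) assms by (intro card_Un_disjoint) (auto intro: finite_subset)
  then show ?thesis
    unfolding scattering_def using P assms(4)
    by (intro exI[of _ "A \<union> S"] exI[of _ P]) auto
qed

text \<open>Here \<open>A\<close> supplies the connecting vertices for the paths of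
  \<open>B\<close>. If they suffice, a single path results and the trivial certificate matches it.
  Otherwise every vertex of \<open>A\<close> saves one path, and adding \<open>A\<close> to the
  deleted set lowers the certificate by the same amount.\<close>

lemma path_cover_scattering_join:
  assumes "finite A" "finite B" "A \<noteq> {}" "A \<inter> B = {}" "joined r A B" "joined r B A"
    and "path_cover r B ps" "scattering r B (length ps)" "length ps \<le> card A \<Longrightarrow> card A \<le> card B"
  shows "\<exists>qs. qs \<noteq> [] \<and> path_cover r (A \<union> B) qs \<and> scattering r (A \<union> B) (length qs)"
proof (cases "length ps \<le> card A")
  case True
  then obtain q where "path_cover r (A \<union> B) [q]"
    using path_cover_join_balanced[of A r B ps] assms by blast
  moreover have "scattering r (A \<union> B) 1"
    using assms(3) by (intro scattering_trivial) simp
  ultimately show ?thesis by (intro exI[of _ "[q]"]) simp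
next
  case False
  define k where "k = length ps - card A"
  have k: "length ps = k + card A" "k \<ge> 1"
    using False by (simp_all add: k_def)
  obtain qs where "path_cover r (A \<union> B) qs" "length qs = k"
    using path_cover_join_few[OF assms(1,7,5,6,4) k] by blast
  moreover have "scattering r (A \<union> B) k"
    using scattering_add_deleted[OF assms(1,2) _ assms(4)] assms(8) k by simp
  ultimately show ?thesis using k(2) by (intro exI[of _ qs]) auto
qed

lemma no_P4_path_cover_scattering:
  assumes "finite V" "V \<noteq> {}" "symp r" "no_P4 r V"
  shows "\<exists>ps. ps \<noteq> [] \<and> path_cover r V ps \<and> scattering r V (length ps)"
  using assms
proof (induction V rule: finite_psubset_induct)
  case (psubset V)
  show ?case
  proof (cases "card V \<ge> 2")
    case False
    then have "card V = 1"
      using psubset card_gt_0_iff[of V] by linarith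
    then obtain v where v: "V = {v}" by (auto simp: card_1_singleton_iff)
    have "path_cover r V [[v]]" by (simp add: v path_cover_def)
    moreover have "scattering r V (length [[v]])"
      using scattering_trivial[of V r] v by simp
    ultimately show ?thesis by blast
  next
    case True
    then obtain A B where AB: "bipartition V A B" "separated r A B \<or> joined r A B"
      using no_P4_bipartition psubset by blast
    then have b: "A \<noteq> {}" "B \<noteq> {}" "A \<inter> B = {}" "A \<union> B = V" "A \<subset> V" "B \<subset> V"
      by (auto simp: bipartition_def)
    have fin: "finite A" "finite B"
      using b psubset by (auto intro: finite_subset)
    obtain ps where ps: "ps \<noteq> []" "path_cover r A ps" "scattering r A (length ps)"
      using psubset.IH[OF b(5)] b psubset no_P4_subset[of r V A] by blast
    obtain qs where qs: "qs \<noteq> []" "path_cover r B qs" "scattering r B (length qs)"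
      using psubset.IH[OF b(6)] b psubset no_P4_subset[of r V B] by blast
    from AB(2) show ?thesis
    proof
      assume sep: "separated r A B"
      then have "separated r B A"
        using psubset.prems(2) by (auto simp: separated_def dest: sympD)
      then have "scattering r V (length (ps @ qs))"
        using scattering_union[OF fin ps(3) qs(3) b(3) sep] b(4) by simp
      then show ?thesis
        using path_cover_append[OF ps(2) qs(2) b(3)] b(4) ps(1) by blast
    next
      assume j: "joined r A B"
      then have j': "joined r B A"
        using psubset.prems(2) by (auto simp: joined_def dest: sympD)
      show ?thesis
      \<comment> \<open>This decides which side connects the paths of the other. \<open>A\<close>
        does if it is too small to glue all of \<open>qs\<close> together or is no larger than
        \<open>B\<close>; otherwise \<open>card B \<le> card A\<close> and the roles are
        exchanged.\<close>
      proof (cases "length qs > card A \<or> card A \<le> card B")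
        case True
        then show ?thesis
          using path_cover_scattering_join[OF fin b(1,3) j j' qs(2,3)] b(4) by auto
      next
        case False
        then have "card B \<le> card A" by simp
        moreover have "B \<inter> A = {}" "B \<union> A = V" using b by auto
        ultimately show ?thesis
          using path_cover_scattering_join[OF fin(2,1) b(2) _ j' j ps(2,3)] by simp
      qed
    qed
  qed
qed

section \<open>Light claws from scattering\<close>

lemma three_distinct_elements:
  assumes "card T \<ge> 3"
  obtains X Y Z where "X \<in> T" "Y \<in> T" "Z \<in> T" "X \<noteq> Y" "X \<noteq> Z" "Y \<noteq> Z"
proof -
  obtain U where "U \<subseteq> T" "card U = 3"
    using assms obtain_subset_with_card_n by metis
  then show ?thesis
    using that by (auto simp: card_3_iff)
qed

text \<open>A vertex \<open>w\<close> of a part \<open>Z\<close> has its neighbours in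
  \<open>S\<close> and \<open>Z - {w}\<close>, so its degree is at most
  \<open>card S + card Z - 1\<close>. The degree sum is thus at most
  \<open>2 * card S + card X + card Y - 2\<close>. The other parts are nonempty and number at least
  \<open>card S\<close>, so \<open>card V\<close> is at least
  \<open>2 * card S + card X + card Y\<close>.\<close>

lemma scattered_degree_sum:
  assumes V: "finite V" "S \<subseteq> V" and P: "scattered r P" "\<Union>P = V - S" "card S + 2 \<le> card P"
    and irr: "irreflp r" and XY: "X \<in> P" "Y \<in> P" "X \<noteq> Y" "x \<in> X" "y \<in> Y"
  shows "card {z \<in> V. r x z} + card {z \<in> V. r y z} + 2 \<le> card V"
proof -
  have finS: "finite S" using V finite_subset by blast
  have finP: "finite Z" if "Z \<in> P" for Z
  proof (rule finite_subset[OF _ V(1)])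
    show "Z \<subseteq> V" using that P(2) by blast
  qed
  have deg: "card {z \<in> V. r w z} + 1 \<le> card S + card Z" if "Z \<in> P" "w \<in> Z" for Z w
  proof -
    have "{z \<in> V. r w z} \<subseteq> S \<union> (Z - {w})"
    proof
      fix z assume z: "z \<in> {z \<in> V. r w z}"
      show "z \<in> S \<union> (Z - {w})"
      proof (cases "z \<in> S")
        case False
        then obtain Z' where Z': "Z' \<in> P" "z \<in> Z'" using z P(2) by blast
        have "Z' = Z"
          using P(1) that Z' z unfolding scattered_def separated_def by blast
        then show ?thesis using Z' z irr by (auto dest: irreflpD)
      qed simp
    qed
    then have "card {z \<in> V. r w z} \<le> card (S \<union> (Z - {w}))"
      using finS finP that by (intro card_mono) auto
    also have "\<dots> \<le> card S + card (Z - {w})" by (rule card_Un_le)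
    finally show ?thesis
      using card.remove[OF finP[OF that(1)] that(2)] by linarith
  qed
  have "card (V - S) = sum card P"
    using card_Union_disjoint[of P] P(1,2) finP by (auto simp: scattered_def pairwise_def disjnt_def)
  also have "\<dots> = card X + card Y + sum card (P - {X, Y})"
  proof -
    have "sum card P = card X + sum card (P - {X})"
      using P(1) XY by (intro sum.remove) (auto simp: scattered_def)
    also have "sum card (P - {X}) = card Y + sum card (P - {X} - {Y})"
      using P(1) XY by (intro sum.remove) (auto simp: scattered_def)
    also have "P - {X} - {Y} = P - {X, Y}" by blast
    finally show ?thesis by simp
  qed
  finally have "card (V - S) = card X + card Y + sum card (P - {X, Y})" .
  moreover have "card (P - {X, Y}) \<le> sum card (P - {X, Y})"
  proof -
    have "1 \<le> card Z" if "Z \<in> P - {X, Y}" for Z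
      using that finP P(1) by (auto simp: scattered_def Suc_le_eq card_gt_0_iff)
    then show ?thesis
      using sum_mono[of "P - {X, Y}" "\<lambda>_. 1::nat" card] by simp
  qed
  moreover have "card (P - {X, Y}) = card P - 2"
    using XY P(1) by (subst card_Diff_subset) (auto simp: scattered_def)
  moreover have "card V = card S + card (V - S)"
    using V finS by (metis card_Diff_subset card_mono le_add_diff_inverse)
  ultimately show ?thesis
    using deg[OF XY(1,4)] deg[OF XY(2,5)] P(3) by linarith
qed

text \<open>Induction on \<open>S\<close> replaces the choice of a minimal \<open>S\<close>.\<close>

lemma light_claw_of_scattered:
  assumes "finite V" "symp r" "irreflp r"
    and conn: "\<And>A B. bipartition V A B \<Longrightarrow> \<not> separated r A B"
    and "finite S" "S \<subseteq> V" "scattered r P" "\<Union>P = V - S" "card S + 2 \<le> card P"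
  shows "\<exists>s\<in>V. \<exists>L\<subseteq>V. card L = 3 \<and> s \<notin> L \<and> (\<forall>x\<in>L. r s x) \<and>
    (\<forall>x\<in>L. \<forall>y\<in>L. x \<noteq> y \<longrightarrow>
       \<not> r x y \<and> card {z \<in> V. r x z} + card {z \<in> V. r y z} + 2 \<le> card V)"
  using assms(5-)
proof (induction S arbitrary: P rule: finite_induct)
  \<comment> \<open>With nothing deleted there are at least two parts, and one of them against the
    union of the others contradicts \<open>conn\<close>.\<close>
  case empty
  then have "P \<noteq> {}" by auto
  then obtain X where X: "X \<in> P" by blast
  have "P - {X} \<noteq> {}"
  proof
    assume "P - {X} = {}"
    then have "P = {X}" using X by blast
    then show False using empty by simp
  qed
  then obtain Y where Y: "Y \<in> P - {X}" by blast
  have P: "{} \<notin> P" "\<And>Y. Y \<in> P - {X} \<Longrightarrow> X \<inter> Y = {} \<and> separated r X Y"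
    using X empty.prems(2) by (auto simp: scattered_def)
  have "X \<union> \<Union>(P - {X}) = V"
    using X empty.prems(3) by auto
  moreover have "X \<noteq> {}" "Y \<noteq> {}" using P(1) X Y by auto
  moreover have "X \<inter> \<Union>(P - {X}) = {}" using P(2) by blast
  ultimately have "bipartition V X (\<Union>(P - {X}))"
    using Y unfolding bipartition_def by auto
  moreover have "separated r X (\<Union>(P - {X}))"
    using P(2) unfolding separated_def by blast
  ultimately show ?case using conn by blast
next
  case (insert s S)
  have sV: "s \<in> V" "s \<notin> \<Union>P" using insert.prems(1,3) by auto
  \<comment> \<open>The parts in which \<open>s\<close> has a neighbour: three of them supply the
    leaves of a claw centred at \<open>s\<close>.\<close>
  define T where "T = {X \<in> P. \<exists>x\<in>X. r s x}"
  have TP: "T \<subseteq> P" by (auto simp: T_def)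
  have finP: "finite P" "finite T"
    using insert.prems(2) finite_subset[OF TP] by (auto simp: scattered_def)
  show ?case
  proof (cases "card T \<ge> 3")
    case True
    then obtain X Y Z where T: "X \<in> T" "Y \<in> T" "Z \<in> T" and ne: "X \<noteq> Y" "X \<noteq> Z" "Y \<noteq> Z"
      by (rule three_distinct_elements)
    from T obtain x y z where xyz: "x \<in> X" "r s x" "y \<in> Y" "r s y" "z \<in> Z" "r s z"
      by (auto simp: T_def)
    have XYZ: "X \<in> P" "Y \<in> P" "Z \<in> P" using T TP by auto
    have disj: "X \<inter> Y = {}" "X \<inter> Z = {}" "Y \<inter> Z = {}"
      using XYZ ne insert.prems(2) by (auto simp: scattered_def)
    have light: "\<not> r u v \<and> card {z \<in> V. r u z} + card {z \<in> V. r v z} + 2 \<le> card V"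
      if "U \<in> P" "W \<in> P" "U \<noteq> W" "u \<in> U" "v \<in> W" for U W u v
    proof
      show "\<not> r u v"
        using that insert.prems(2) by (auto simp: scattered_def separated_def)
      show "card {z \<in> V. r u z} + card {z \<in> V. r v z} + 2 \<le> card V"
        using scattered_degree_sum[OF assms(1) insert.prems(1,2,3,4) assms(3) that] .
    qed
    have "x \<noteq> y" "x \<noteq> z" "y \<noteq> z" using disj xyz by auto
    then have "card {x, y, z} = 3" by simp
    moreover have "{x, y, z} \<subseteq> V" "s \<notin> {x, y, z}"
      using XYZ xyz insert.prems(3) sV by auto
    moreover have "\<forall>u\<in>{x, y, z}. r s u" using xyz by auto
    moreover have "\<forall>u\<in>{x, y, z}. \<forall>v\<in>{x, y, z}. u \<noteq> v \<longrightarrow>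
       \<not> r u v \<and> card {z \<in> V. r u z} + card {z \<in> V. r v z} + 2 \<le> card V"
      using light[of X Y x y] light[of Y X y x] light[of X Z x z] light[of Z X z x]
        light[of Y Z y z] light[of Z Y z y] XYZ ne xyz by auto
    ultimately show ?thesis using sV(1) by blast
  next
    case False
    \<comment> \<open>Now \<open>s\<close> is returned to the graph and merged with the at most two
      parts that it touches. The number of parts drops by at most one, as does the size of the
      deleted set, so the surplus of two survives. If \<open>T\<close> is empty, \<open>{s}\<close>
      becomes a new part.\<close>
    let ?X = "insert s (\<Union>T)"
    let ?P = "insert ?X (P - T)"
    have sep: "separated r ?X Y \<and> separated r Y ?X \<and> ?X \<inter> Y = {}" if Y: "Y \<in> P - T" for Y
    proof (intro conjI)
      have s: "\<not> r s y" "\<not> r y s" if "y \<in> Y" for y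
        using that Y assms(2) by (auto simp: T_def dest: sympD)
      have ST: "separated r Z Y" "separated r Y Z" "Z \<inter> Y = {}" if "Z \<in> T" for Z
      proof -
        have "Z \<in> P" "Y \<in> P" "Z \<noteq> Y" using that Y TP by auto
        then show "separated r Z Y" "separated r Y Z" "Z \<inter> Y = {}"
          using insert.prems(2) unfolding scattered_def by metis+
      qed
      show "separated r ?X Y" "separated r Y ?X"
        using s ST unfolding separated_def by blast+
      show "?X \<inter> Y = {}" using ST(3) sV(2) Y by blast
    qed
    have P': "scattered r ?P"
      using insert.prems(2) sep unfolding scattered_def by (simp add: Int_commute)
    have V': "\<Union>?P = V - S"
    proof -
      have "\<Union>?P = insert s (\<Union>P)" using TP by blast
      then show ?thesis using insert.prems(1,3) insert.hyps(2) by auto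
    qed
    have card': "card S + 2 \<le> card ?P"
    proof -
      have "?X \<notin> P - T" using sV(2) by blast
      then have "card ?P = Suc (card P - card T)"
        using finP TP by (simp add: card_Diff_subset)
      moreover have "card (insert s S) = Suc (card S)" using insert.hyps by simp
      ultimately show ?thesis using False insert.prems(4) by simp
    qed
    have "S \<subseteq> V" using insert.prems(1) by simp
    then show ?thesis by (rule insert.IH[OF _ P' V' card'])
  qed
qed

section \<open>Transfer to digraphs\<close>

context graph
begin

lemma symp_dominates: "symp (\<lambda>u v. u \<rightarrow>\<^bsub>G\<^esub> v)"
  by (rule sympI) (rule arcs_ends_symmetric[OF sym_arcs])

lemma irreflp_dominates: "irreflp (\<lambda>u v. u \<rightarrow>\<^bsub>G\<^esub> v)"
  by (rule irreflpI) (rule notI, erule adj_not_same)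

text \<open>Without parallel arcs, an arc leaving \<open>u\<close> is determined by its
  head.\<close>

lemma out_degree_eq_card_neighbours: "out_degree G u = card {v \<in> verts G. u \<rightarrow>\<^bsub>G\<^esub> v}"
proof -
  have "inj_on (head G) (out_arcs G u)"
    by (rule inj_onI, rule no_multi_arcs) (simp_all add: arc_to_ends_def)
  moreover have "head G ` out_arcs G u = {v \<in> verts G. u \<rightarrow>\<^bsub>G\<^esub> v}"
    unfolding arcs_ends_conv out_arcs_def image_def by auto
  ultimately show ?thesis
    using card_image[of "head G" "out_arcs G u"] by (simp add: out_degree_def)
qed

lemma dominates_induce_subgraph:
  "u \<rightarrow>\<^bsub>G \<restriction> W\<^esub> v \<longleftrightarrow> u \<in> W \<and> v \<in> W \<and> u \<rightarrow>\<^bsub>G\<^esub> v"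
  by (auto simp: arcs_ends_conv)

text \<open>The predicate \<open>connected\<close> refers to reachability in the symmetric closure,
  which for the symmetric \<open>G\<close> is reachability in \<open>G\<close> itself. A walk that
  starts in \<open>A\<close> could leave \<open>A\<close> only along an arc into
  \<open>B\<close>.\<close>

lemma not_separated_of_connected:
  assumes "connected G" "bipartition (verts G) A B"
  shows "\<not> separated (\<lambda>u v. u \<rightarrow>\<^bsub>G\<^esub> v) A B"
proof
  assume sep: "separated (\<lambda>u v. u \<rightarrow>\<^bsub>G\<^esub> v) A B"
  obtain a b where ab: "a \<in> A" "b \<in> B" using assms(2) by (auto simp: bipartition_def)
  then have "a \<in> verts G" "b \<in> verts G" using assms(2) by (auto simp: bipartition_def)
  then have "a \<rightarrow>\<^sup>*\<^bsub>mk_symmetric G\<^esub> b"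
    using assms(1) by (simp add: connected_def strongly_connected_def mk_symmetric_def)
  then have "a \<rightarrow>\<^sup>*\<^bsub>G\<^esub> b"
    by (simp only: reachable_mk_symmetric_eq[OF sym_arcs])
  then have "b \<in> A"
  proof (induction rule: reachable_induct)
    case base
    show ?case by (rule ab(1))
  next
    case (step x y)
    then have "y \<in> A \<union> B" using assms(2) by (auto simp: bipartition_def)
    then show ?case using step sep by (auto simp: separated_def)
  qed
  then show False using ab assms(2) by (auto simp: bipartition_def)
qed

lemma no_P4_of_P4_free:
  assumes "P4_free G"
  shows "no_P4 (\<lambda>u v. u \<rightarrow>\<^bsub>G\<^esub> v) (verts G)"
  unfolding no_P4_def
proof (intro ballI impI, rule ccontr)
  fix a b c d
  assume V: "a \<in> verts G" "b \<in> verts G" "c \<in> verts G" "d \<in> verts G"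
    and e: "a \<rightarrow>\<^bsub>G\<^esub> b" "b \<rightarrow>\<^bsub>G\<^esub> c" "c \<rightarrow>\<^bsub>G\<^esub> d"
    and "\<not> (a \<rightarrow>\<^bsub>G\<^esub> c \<or> a \<rightarrow>\<^bsub>G\<^esub> d \<or> b \<rightarrow>\<^bsub>G\<^esub> d)"
  then have n: "\<not> a \<rightarrow>\<^bsub>G\<^esub> c" "\<not> a \<rightarrow>\<^bsub>G\<^esub> d" "\<not> b \<rightarrow>\<^bsub>G\<^esub> d" by auto
  have sym: "u \<rightarrow>\<^bsub>G\<^esub> v \<longleftrightarrow> v \<rightarrow>\<^bsub>G\<^esub> u" for u v
    using symp_dominates by (auto dest: sympD)
  have irr: "\<not> u \<rightarrow>\<^bsub>G\<^esub> u" for u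
    using irreflp_dominates by (auto dest: irreflpD)
  have dist: "a \<noteq> b" "a \<noteq> c" "a \<noteq> d" "b \<noteq> c" "b \<noteq> d" "c \<noteq> d"
    using e n sym irr by metis+
  let ?W = "{a, b, c, d}"
  let ?H = "G \<restriction> ?W"
  define f where "f = (\<lambda>v. if v = a then 0 else if v = b then 1 else if v = c then 2 else 3 :: nat)"
  have f: "f a = 0" "f b = 1" "f c = 2" "f d = 3" using dist by (auto simp: f_def)
  \<comment> \<open>Arcs of the path graph are pairs of vertices, so each arc is sent to the pair of
    images of its ends, with \<open>fst\<close> and \<open>snd\<close> as the new tail and head
    maps. The absence of parallel arcs makes this injective.\<close>
  define h where "h = \<lparr> iso_verts = f, iso_arcs = (\<lambda>e. (f (tail G e), f (head G e))),
    iso_head = snd, iso_tail = fst \<rparr>"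
  have sub: "induced_subgraph ?H G" using V by (intro induced_induce) auto
  then have wf: "wf_digraph ?H" by (simp add: induced_subgraph_def subgraph_def)
  have inj: "inj_on f ?W" using f by (auto simp: inj_on_def)
  have inj': "inj_on (iso_arcs h) (arcs ?H)"
  proof (rule inj_onI)
    fix e1 e2 assume A: "e1 \<in> arcs ?H" "e2 \<in> arcs ?H" "iso_arcs h e1 = iso_arcs h e2"
    then have "tail G e1 = tail G e2" "head G e1 = head G e2"
      using inj_onD[OF inj] by (simp_all add: h_def)
    then show "e1 = e2" using A(1,2) no_multi_arcs[of e1 e2] by (simp add: arc_to_ends_def)
  qed
  have "pre_digraph.digraph_isomorphism ?H h"
    unfolding pre_digraph.digraph_isomorphism_def using wf inj inj' by (auto simp: h_def)
  moreover have "with_proj (path_graph 4) = app_iso h ?H"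
  proof -
    have "f ` ?W = {..<4}" using f by auto
    moreover have "iso_arcs h ` arcs ?H = parcs (path_graph 4)"
    proof -
      have "iso_arcs h ` arcs ?H = (\<lambda>(u, v). (f u, f v)) ` {(u, v). u \<in> ?W \<and> v \<in> ?W \<and> u \<rightarrow>\<^bsub>G\<^esub> v}"
        unfolding arcs_ends_conv image_def by (auto simp: h_def)
      also have "{(u, v). u \<in> ?W \<and> v \<in> ?W \<and> u \<rightarrow>\<^bsub>G\<^esub> v} = {(a,b),(b,a),(b,c),(c,b),(c,d),(d,c)}"
        using e n sym irr by auto
      also have "(\<lambda>(u, v). (f u, f v)) ` \<dots> = {(0,1),(1,0),(1,2),(2,1),(2,3),(3,2)}"
        using f by simp
      also have "\<dots> = parcs (path_graph 4)"
        by (auto simp: path_graph_def)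
      finally show ?thesis .
    qed
    ultimately show ?thesis
      by (simp add: with_proj_def app_iso_def) (simp add: h_def path_graph_def)
  qed
  ultimately have "digraph_iso ?H (with_proj (path_graph 4))"
    unfolding digraph_iso_def by blast
  then show False using sub assms by (auto simp: P4_free_def)
qed

lemma complete_bipartite_induced_claw:
  assumes "s \<in> verts G" "L \<subseteq> verts G" "card L = 3" "s \<notin> L" "\<forall>x\<in>L. s \<rightarrow>\<^bsub>G\<^esub> x"
    and "\<forall>x\<in>L. \<forall>y\<in>L. \<not> x \<rightarrow>\<^bsub>G\<^esub> y"
  shows "complete_bipartite_digraph 1 3 (G \<restriction> insert s L)"
proof -
  have "induced_subgraph (G \<restriction> insert s L) G"
    using assms by (intro induced_induce) auto
  then have "graph (G \<restriction> insert s L)"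
    by (simp add: graph_def pseudo_graph_def digraphI_induced induced_graph_imp_graph digraph.axioms(1))
  moreover have "x \<rightarrow>\<^bsub>G\<^esub> s" if "x \<in> L" for x
    using assms(5) symp_dominates that by (auto dest: sympD)
  then have "arcs_ends (G \<restriction> insert s L) = {s} \<times> L \<union> L \<times> {s}"
    using assms(5,6) irreflpD[OF irreflp_dominates]
    by (auto simp: dominates_induce_subgraph)
  ultimately have "graph (G \<restriction> insert s L) \<and> verts (G \<restriction> insert s L) = {s} \<union> L \<and>
      {s} \<inter> L = {} \<and> card {s} = 1 \<and> card L = 3 \<and>
      arcs_ends (G \<restriction> insert s L) = {s} \<times> L \<union> L \<times> {s}"
    using assms(3,4) by simp
  then show ?thesis
    unfolding complete_bipartite_digraph_def by blast
qed

end

text \<open>This links the lists of \<open>path_cover\<close> to \<open>vwalk\<close>, which is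
  phrased through the arcs of a walk.\<close>

lemma successively_iff_vwalk_arcs: "successively r p \<longleftrightarrow> (\<forall>(u, v)\<in>set (vwalk_arcs p). r u v)"
  by (induction p rule: vwalk_arcs.induct) auto

theorem theorem8:
  fixes G :: "('a, 'b) pre_digraph"
  assumes "graph G"
    and "connected G"
    and "claw_o_minus_1_heavy G"
    and "P4_free G"
  shows "traceable G"
proof -
  interpret graph G by (rule assms(1))
  let ?r = "\<lambda>u v. u \<rightarrow>\<^bsub>G\<^esub> v"
  have "verts G \<noteq> {}"
    using assms(2) by (simp add: connected_def strongly_connected_def mk_symmetric_def)
  then obtain ps where ps: "ps \<noteq> []" "path_cover ?r (verts G) ps" "scattering ?r (verts G) (length ps)"
    using no_P4_path_cover_scattering[OF finite_verts _ symp_dominates no_P4_of_P4_free[OF assms(4)]]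
    by blast
  have "length ps = 1"
  proof (rule ccontr)
    assume "length ps \<noteq> 1"
    then have "length ps \<ge> 2" using ps(1) by (cases ps; cases "tl ps") auto
    then obtain S P where SP: "S \<subseteq> verts G" "scattered ?r P" "\<Union>P = verts G - S" "card S + 2 \<le> card P"
      using ps(3) by (auto simp: scattering_def)
    obtain s L where sL: "s \<in> verts G" "L \<subseteq> verts G" "card L = 3" "s \<notin> L" "\<forall>x\<in>L. ?r s x"
      and L: "\<forall>x\<in>L. \<forall>y\<in>L. x \<noteq> y \<longrightarrow> \<not> ?r x y \<and>
        card {z \<in> verts G. ?r x z} + card {z \<in> verts G. ?r y z} + 2 \<le> card (verts G)"
      using light_claw_of_scattered[OF finite_verts symp_dominates irreflp_dominates
          not_separated_of_connected[OF assms(2)] finite_subset[OF SP(1) finite_verts] SP]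
      by blast
    have "\<not> ?r x y" if "x \<in> L" "y \<in> L" for x y
    proof (cases "x = y")
      case True
      then show ?thesis using adj_not_same by blast
    next
      case False
      then show ?thesis using L that by simp
    qed
    then have claw: "complete_bipartite_digraph 1 3 (G \<restriction> insert s L)"
      using complete_bipartite_induced_claw[OF sL] by blast
    have "induced_subgraph (G \<restriction> insert s L) G"
      using sL by (intro induced_induce) auto
    then have "\<exists>u\<in>verts (G \<restriction> insert s L). \<exists>v\<in>verts (G \<restriction> insert s L). u \<noteq> v \<and> \<not> ?r u v \<and>
        out_degree G u + out_degree G v \<ge> card (verts G) - 1"
      using assms(3) claw unfolding claw_o_minus_1_heavy_def by blast
    then obtain u v where uv: "u \<in> insert s L" "v \<in> insert s L" "u \<noteq> v" "\<not> ?r u v"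
      "out_degree G u + out_degree G v \<ge> card (verts G) - 1"
      unfolding induce_subgraph_verts by blast
    \<comment> \<open>The centre \<open>s\<close> is adjacent to every other vertex of the claw, so
      two distinct nonadjacent vertices must both be leaves.\<close>
    have "u \<in> L" "v \<in> L"
      using uv sL(5) symp_dominates by (auto dest: sympD)
    then have "out_degree G u + out_degree G v + 2 \<le> card (verts G)"
      using L uv(3) by (simp add: out_degree_eq_card_neighbours)
    \<comment> \<open>The preceding bound gives \<open>card (verts G) \<ge> 2\<close>, so the
      natural subtraction of 1 is exact and a degree sum of at most \<open>n - 2\<close> contradicts
      one of at least \<open>n - 1\<close>, where \<open>n\<close> is the number of
      vertices.\<close>
    then show False using uv(5) by linarith
  qed
  then obtain p where "ps = [p]" by (auto simp: length_Suc_conv)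
  then have "vpath p G \<and> set p = verts G"
    using ps(2) by (auto simp: path_cover_def vpath_def vwalk_def successively_iff_vwalk_arcs)
  then show ?thesis unfolding traceable_def by blast
qed

end
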